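(* Let $A\in\mathbb{R}_+^{n\times n}$ be definite and let $X=\operatorname{diag}(x)$ with $x\in\mathbb{R}_+^n$ positive. Then $X^{-1}AX$ is strictly visualized if any of the following conditions is true: (1) $x$ is a positive linear combination of all columns of the Kleene star $A^*$; (2) $A$ is irreducible and $x$ is a positive log-convex combination of all columns of $A^*$.
   Context: $\mathbb{R}_+$ is the set of nonnegative reals, $n\ge 1$, $[n]=\{1,\dots,n\}$. Max algebra: $a\oplus b=\max(a,b)$, $\otimes$ is ordinary multiplication; for matrices $(A\oplus B)_{ij}=\max(a_{ij},b_{ij})$, $(A\otimes B)_{ij}=\max_k a_{ik}b_{kj}$; $A^k$ denotes the $k$-fold $\otimes$-power. For $A=(a_{ij})\in\mathbb{R}_+^{n\times n}$, the digraph $D_A$ has node set $[n]$ and all edges $(i,j)\in[n]\times[n]$ with weights $a_{ij}$. The weight of a path $(i_1,\dots,i_p)$ is $a_{i_1i_2}\cdots a_{i_{p-1}i_p}$ (equal to $1$ if $p=1$). A path is positive if its weight is positive. A cycle $\sigma=(i_1,\dots,i_k,i_1)$, $k\ge1$, has geometric mean $(a_{i_1i_2}\cdots a_{i_ki_1})^{1/k}$. $\lambda(A)$ is the maximum of the geometric means over all cycles (the maximum cycle geometric mean). $A$ is definite if $\lambda(A)=1$. $A$ is irreducible if for any nodes $i,j$ there is a positive path from $i$ to $j$ in $D_A$. A cycle is critical if its geometric mean equals $\lambda(A)$; $E_c(A)$ is the set of edges that belong to critical cycles. For definite $A$, the Kleene star is $A^*=I\oplus A\oplus A^2\oplus\cdots$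 (which is finite). $\operatorname{diag}(x)$ is the diagonal matrix with diagonal entries $x_1,\dots,x_n$; $x$ positive means all $x_i>0$. A matrix $B=(b_{ij})\in\mathbb{R}_+^{n\times n}$ is strictly visualized if $b_{ij}=\lambda(B)$ for all $(i,j)\in E_c(B)$ and $b_{ij}<\lambda(B)$ for all $(i,j)\notin E_c(B)$. A positive linear combination of $y^1,\dots,y^m\in\mathbb{R}_+^n$ is $\sum_i\lambda_iy^i$ with all $\lambda_i>0$; a positive log-convex combination is $\prod_i (y^i)^{\lambda_i}$ with all $\lambda_i>0$ and $\sum_i\lambda_i=1$, powers and products taken componentwise. *)

theory Defs
  imports "HOL-Analysis.Analysis"
begin

definition nonneg_mat :: "real ^ 'n ^ 'n \<Rightarrow> bool" where
  "nonneg_mat A \<longleftrightarrow> (\<forall>i j. 0 \<le> A $ i $ j)"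

definition max_mult :: "real ^ 'n ^ 'n \<Rightarrow> real ^ 'n ^ 'n \<Rightarrow> real ^ 'n ^ 'n"
    (infixl "\<otimes>\<^sub>m" 70) where
  "A \<otimes>\<^sub>m B = (\<chi> i j. Max (range (\<lambda>k. A $ i $ k * B $ k $ j)))"

text \<open>On nonnegative matrices the unit matrix of max algebra is the ordinary one.\<close>

primrec max_power :: "real ^ 'n ^ 'n \<Rightarrow> nat \<Rightarrow> real ^ 'n ^ 'n" where
  "max_power A 0 = mat 1"
| "max_power A (Suc k) = A \<otimes>\<^sub>m max_power A k"

text \<open>The entrywise supremum of all max-algebraic powers. It is taken in the reals, so it is
  meaningful only when the powers are bounded, as they are for definite matrices.\<close>

definition kleene_star :: "real ^ 'n ^ 'n \<Rightarrow> real ^ 'n ^ 'n" where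
  "kleene_star A = (\<chi> i j. SUP k. max_power A k $ i $ j)"

text \<open>A path is a nonempty list of nodes (every pair of nodes is an edge). The cycle
  \<open>(i\<^sub>1, \<dots>, i\<^sub>k, i\<^sub>1)\<close> is represented by the nonempty list \<open>[i\<^sub>1, \<dots>, i\<^sub>k]\<close>;
  nodes may repeat.\<close>

definition path_edges :: "'n list \<Rightarrow> ('n \<times> 'n) list" where
  "path_edges p = zip p (tl p)"

definition path_weight :: "real ^ 'n ^ 'n \<Rightarrow> 'n list \<Rightarrow> real" where
  "path_weight A p = prod_list (map (\<lambda>(i, j). A $ i $ j) (path_edges p))"

definition cycle_path :: "'n list \<Rightarrow> 'n list" where
  "cycle_path c = c @ [hd c]"

definition cycle_mean :: "real ^ 'n ^ 'n \<Rightarrow> 'n list \<Rightarrow> real" where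
  "cycle_mean A c = root (length c) (path_weight A (cycle_path c))"

text \<open>There are infinitely many cycles, hence a supremum; for nonnegative matrices it is
  attained (by an elementary cycle), so it is the maximum.\<close>

definition max_cycle_mean :: "real ^ 'n ^ 'n \<Rightarrow> real" where
  "max_cycle_mean A = (SUP c\<in>{c. c \<noteq> []}. cycle_mean A c)"

definition definite :: "real ^ 'n ^ 'n \<Rightarrow> bool" where
  "definite A \<longleftrightarrow> max_cycle_mean A = 1"

definition irreducible_mat :: "real ^ 'n ^ 'n \<Rightarrow> bool" where
  "irreducible_mat A \<longleftrightarrow>
    (\<forall>i j. \<exists>p. p \<noteq> [] \<and> hd p = i \<and> last p = j \<and> path_weight A p > 0)"

definition critical_cycle :: "real ^ 'n ^ 'n \<Rightarrow> 'n list \<Rightarrow> bool" where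
  "critical_cycle A c \<longleftrightarrow> c \<noteq> [] \<and> cycle_mean A c = max_cycle_mean A"

definition critical_edges :: "real ^ 'n ^ 'n \<Rightarrow> ('n \<times> 'n) set" where
  "critical_edges A = (\<Union>c\<in>{c. critical_cycle A c}. set (path_edges (cycle_path c)))"

definition strictly_visualized :: "real ^ 'n ^ 'n \<Rightarrow> bool" where
  "strictly_visualized B \<longleftrightarrow> nonneg_mat B \<and>
    (\<forall>i j. (i, j) \<in> critical_edges B \<longrightarrow> B $ i $ j = max_cycle_mean B) \<and>
    (\<forall>i j. (i, j) \<notin> critical_edges B \<longrightarrow> B $ i $ j < max_cycle_mean B)"

definition diag :: "real ^ 'n \<Rightarrow> real ^ 'n ^ 'n" where
  "diag x = (\<chi> i j. if i = j then x $ i else 0)"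

definition pos_linear_comb :: "('m::finite \<Rightarrow> real ^ 'n) \<Rightarrow> real ^ 'n \<Rightarrow> bool" where
  "pos_linear_comb y x \<longleftrightarrow> (\<exists>\<mu>. (\<forall>k. \<mu> k > 0) \<and> x = (\<Sum>k\<in>UNIV. \<mu> k *\<^sub>R y k))"

definition pos_log_convex_comb :: "('m::finite \<Rightarrow> real ^ 'n) \<Rightarrow> real ^ 'n \<Rightarrow> bool" where
  "pos_log_convex_comb y x \<longleftrightarrow>
    (\<exists>\<mu>. (\<forall>k. \<mu> k > 0) \<and> (\<Sum>k\<in>UNIV. \<mu> k) = 1 \<and>
         x = (\<chi> i. \<Prod>k\<in>UNIV. (y k $ i) powr \<mu> k))"

end

theory Submission
  imports Defs
begin

text \<open>Writing \<open>K\<close> for the Kleene star, every column of \<open>K\<close> satisfies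
  \<open>A\<^sub>i\<^sub>j K\<^sub>j\<^sub>k \<le> K\<^sub>i\<^sub>k\<close>. Equality for \<open>k = i\<close> forces \<open>A\<^sub>i\<^sub>j K\<^sub>j\<^sub>i = 1\<close>; as \<open>K\<^sub>j\<^sub>i\<close> is attained by a
  path from \<open>j\<close> to \<open>i\<close>, this puts \<open>(i, j)\<close> on a critical cycle. So for a noncritical edge one of the
  inequalities is strict, and any strictly monotone mean of all columns gives
  \<open>A\<^sub>i\<^sub>j x\<^sub>j < x\<^sub>i\<close>. Diagonal scaling keeps cycle weights, and a critical cycle of the scaled
  matrix has weight 1 with all factors at most 1, hence all equal to 1.\<close>

section \<open>Weights of paths and means of cycles\<close>

lemma path_weight_simps [simp]:
  "path_weight A [] = 1"
  "path_weight A [i] = 1"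
  "path_weight A (i # j # p) = A $ i $ j * path_weight A (j # p)"
  by (simp_all add: path_weight_def path_edges_def)

text \<open>The node \<open>i\<close> ends the first path and starts the second, so cutting there
  loses no edge and repeats none.\<close>

lemma path_weight_append:
  "path_weight A (p @ i # q) = path_weight A (p @ [i]) * path_weight A (i # q)"
proof (induction p)
  case (Cons a p)
  then show ?case by (cases p) auto
qed simp

lemma path_weight_nonneg:
  assumes "nonneg_mat A"
  shows "0 \<le> path_weight A p"
  using assms unfolding path_weight_def nonneg_mat_def
  by (intro prod_list_nonneg) auto

lemma path_weight_le_power:
  assumes "nonneg_mat A" and "\<And>i j. A $ i $ j \<le> M"
  shows "path_weight A (i # p) \<le> M ^ length p"
proof (induction p arbitrary: i)
  case (Cons j p)
  have "0 \<le> A $ i $ j" using assms(1) by (simp add: nonneg_mat_def)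
  then have "A $ i $ j * path_weight A (j # p) \<le> M * M ^ length p"
    using assms Cons[of j] order_trans[OF _ assms(2)]
    by (intro mult_mono) (auto simp: path_weight_nonneg)
  then show ?case by simp
qed simp

lemma cycle_mean_le:
  assumes "nonneg_mat A" and "\<And>i j. A $ i $ j \<le> M" and "c \<noteq> []"
  shows "cycle_mean A c \<le> M"
proof -
  obtain i p where c: "c = i # p" using assms(3) by (cases c) auto
  have "0 \<le> M" using assms(1,2) order_trans unfolding nonneg_mat_def by blast
  have "path_weight A (cycle_path c) \<le> M ^ length c"
    using path_weight_le_power[OF assms(1,2), of i "p @ [i]"] by (simp add: c cycle_path_def)
  then have "cycle_mean A c \<le> root (length c) (M ^ length c)"
    using assms(3) by (simp add: cycle_mean_def)
  also have "\<dots> = M" using assms(3) \<open>0 \<le> M\<close> by (intro real_root_power_cancel) auto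
  finally show ?thesis .
qed

text \<open>\<open>max_cycle_mean\<close> is a real supremum; boundedness is what makes it dominate
  each single cycle mean. The largest entry serves as bound.\<close>

lemma bdd_above_cycle_mean:
  fixes A :: "real ^ 'n ^ 'n"
  assumes "nonneg_mat A"
  shows "bdd_above (cycle_mean A ` {c. c \<noteq> []})"
proof -
  define M where "M = Max (range (\<lambda>(i, j). A $ i $ j))"
  have "A $ i $ j \<le> M" for i j
    unfolding M_def by (rule Max_ge) (auto intro: range_eqI[of _ _ "(i, j)"])
  then show ?thesis
    using cycle_mean_le[OF assms, of M] by (intro bdd_aboveI2[where M = M]) auto
qed

lemma definite_cycle_weight_le_1:
  assumes "nonneg_mat A" and "definite A" and "c \<noteq> []"
  shows "path_weight A (cycle_path c) \<le> 1"
proof -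
  have "cycle_mean A c \<le> max_cycle_mean A"
    unfolding max_cycle_mean_def
    by (rule cSUP_upper) (use assms bdd_above_cycle_mean in auto)
  then show ?thesis
    using assms by (simp add: definite_def cycle_mean_def)
qed

text \<open>A root of positive order is 1 exactly when its argument is 1, so criticality can be read
  off the weight without the root.\<close>

lemma definite_critical_cycle_iff:
  assumes "definite A"
  shows "critical_cycle A c \<longleftrightarrow> c \<noteq> [] \<and> path_weight A (cycle_path c) = 1"
  using assms by (auto simp: critical_cycle_def cycle_mean_def definite_def)

text \<open>A repeated node encloses a cycle of weight at most 1; cutting it out shortens the path
  without lowering its weight. Strong induction on the length removes all repetitions.\<close>

lemma definite_distinct_path:
  assumes "nonneg_mat A" and "definite A" and "p \<noteq> []"
  shows "\<exists>q. q \<noteq> [] \<and> distinct q \<and> hd q = hd p \<and> last q = last p \<and>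
             path_weight A p \<le> path_weight A q"
  using assms(3)
proof (induction p rule: length_induct)
  case (1 p)
  show ?case
  proof (cases "distinct p")
    case True
    with 1 show ?thesis by blast
  next
    case False
    then obtain xs y ys zs where p: "p = xs @ y # ys @ y # zs"
      using not_distinct_decomp[of p] by auto
    define q where "q = xs @ y # zs"
    \<comment> \<open>Splitting at both occurrences of \<open>y\<close> isolates the factor of the
      cycle through \<open>y # ys\<close>.\<close>
    have "path_weight A p = path_weight A (xs @ [y]) *
        (path_weight A (cycle_path (y # ys)) * path_weight A (y # zs))"
      unfolding p cycle_path_def
      using path_weight_append[of A xs y "ys @ y # zs"] path_weight_append[of A "y # ys" y zs]
      by simp
    also have "\<dots> \<le> path_weight A (xs @ [y]) * path_weight A (y # zs)"
      using definite_cycle_weight_le_1[OF assms(1,2)] path_weight_nonneg[OF assms(1)]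
      by (intro mult_left_mono mult_left_le_one_le) auto
    also have "\<dots> = path_weight A q"
      unfolding q_def by (rule path_weight_append[symmetric])
    finally have le: "path_weight A p \<le> path_weight A q" .
    have q: "length q < length p" "q \<noteq> []" "hd q = hd p" "last q = last p"
      by (simp_all add: p q_def hd_append)
    then obtain r where "r \<noteq> []" "distinct r" "hd r = hd q" "last r = last q"
        "path_weight A q \<le> path_weight A r"
      using 1 by blast
    with le q show ?thesis by (metis order_trans)
  qed
qed

section \<open>Max-algebraic powers and the Kleene star\<close>

lemma max_mult_ge: "A $ i $ k * B $ k $ j \<le> (A \<otimes>\<^sub>m B) $ i $ j"
  by (simp add: max_mult_def)

lemma max_mult_attained: "\<exists>k. (A \<otimes>\<^sub>m B) $ i $ j = A $ i $ k * B $ k $ j"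
proof -
  have "Max (range (\<lambda>k. A $ i $ k * B $ k $ j)) \<in> range (\<lambda>k. A $ i $ k * B $ k $ j)"
    by (rule Max_in) auto
  then show ?thesis unfolding max_mult_def by (simp only: vec_lambda_beta image_iff) blast
qed

text \<open>Choosing a maximizing intermediate node in each product traces out a path from
  \<open>i\<close> to \<open>j\<close>.\<close>

lemma max_power_le_path_weight:
  assumes "nonneg_mat A"
  shows "\<exists>p. p \<noteq> [] \<and> hd p = i \<and> last p = j \<and> max_power A k $ i $ j \<le> path_weight A p"
proof (induction k arbitrary: i)
  case 0
  show ?case
  proof (cases "i = j")
    case True
    then show ?thesis by (intro exI[of _ "[i]"]) (simp add: mat_def)
  next
    case False
    \<comment> \<open>The entry of the unit matrix is 0 here, so any path from \<open>i\<close> to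
      \<open>j\<close> will do; a single edge is the simplest.\<close>
    then show ?thesis
      using assms by (intro exI[of _ "[i, j]"]) (simp add: mat_def nonneg_mat_def)
  qed
next
  case (Suc k)
  obtain m where m: "max_power A (Suc k) $ i $ j = A $ i $ m * max_power A k $ m $ j"
    using max_mult_attained[of A "max_power A k" i j] by auto
  obtain p where p: "p \<noteq> []" "hd p = m" "last p = j"
      "max_power A k $ m $ j \<le> path_weight A p"
    using Suc by blast
  have "path_weight A (i # p) = A $ i $ m * path_weight A p"
    using p(1,2) by (cases p) auto
  moreover have "0 \<le> A $ i $ m" using assms by (simp add: nonneg_mat_def)
  ultimately have "max_power A (Suc k) $ i $ j \<le> path_weight A (i # p)"
    using m p(4) by (simp add: mult_left_mono)
  with p show ?case by (intro exI[of _ "i # p"]) auto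
qed

text \<open>The path \<open>q\<close> does not depend on \<open>k\<close>: it is a heaviest path
  among the finitely many paths from \<open>i\<close> to \<open>j\<close> without repeated nodes.
  This makes the supremum in \<open>kleene_star\<close> finite and bounds it by a path
  weight.\<close>

lemma definite_max_power_bound:
  fixes A :: "real ^ 'n ^ 'n"
  assumes "nonneg_mat A" and "definite A"
  obtains q where "q \<noteq> []" "hd q = i" "last q = j"
    "\<And>k. max_power A k $ i $ j \<le> path_weight A q"
proof -
  define Q where "Q = {q :: 'n list. q \<noteq> [] \<and> distinct q \<and> hd q = i \<and> last q = j}"
  have ex: "\<exists>q\<in>Q. max_power A k $ i $ j \<le> path_weight A q" for k
  proof -
    obtain p where p: "p \<noteq> []" "hd p = i" "last p = j"
        "max_power A k $ i $ j \<le> path_weight A p"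
      using max_power_le_path_weight[OF assms(1)] by blast
    obtain q where "q \<noteq> []" "distinct q" "hd q = hd p" "last q = last p"
        "path_weight A p \<le> path_weight A q"
      using definite_distinct_path[OF assms p(1)] by blast
    with p show ?thesis unfolding Q_def by (intro bexI[of _ q]) auto
  qed
  have fin: "finite Q"
    by (rule finite_subset[OF _ finite_subset_distinct[of UNIV]]) (auto simp: Q_def)
  have "Max (path_weight A ` Q) \<in> path_weight A ` Q"
    using fin ex by (intro Max_in) auto
  then obtain q where "q \<in> Q" "path_weight A q = Max (path_weight A ` Q)"
    by auto
  then have q: "q \<in> Q" "\<And>r. r \<in> Q \<Longrightarrow> path_weight A r \<le> path_weight A q"
    using fin by simp_all
  show ?thesis
  proof (rule that[of q])
    show "max_power A k $ i $ j \<le> path_weight A q" for k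
      using ex[of k] q(2) order_trans by blast
  qed (use q(1) Q_def in auto)
qed

lemma max_power_le_kleene_star:
  assumes "nonneg_mat A" and "definite A"
  shows "max_power A k $ i $ j \<le> kleene_star A $ i $ j"
proof -
  obtain q where "\<And>k. max_power A k $ i $ j \<le> path_weight A q"
    using definite_max_power_bound[OF assms, of i j] by metis
  then show ?thesis
    unfolding kleene_star_def by (auto intro!: cSUP_upper bdd_aboveI2)
qed

lemma kleene_star_le_path_weight:
  assumes "nonneg_mat A" and "definite A"
  obtains q where "q \<noteq> []" "hd q = i" "last q = j" "kleene_star A $ i $ j \<le> path_weight A q"
proof -
  obtain q where q: "q \<noteq> []" "hd q = i" "last q = j"
      "\<And>k. max_power A k $ i $ j \<le> path_weight A q"
    using definite_max_power_bound[OF assms, of i j] by metis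
  have "kleene_star A $ i $ j \<le> path_weight A q"
    unfolding kleene_star_def using q(4) by (auto intro: cSUP_least)
  with q show ?thesis by (intro that)
qed

lemma kleene_star_nonneg:
  assumes "nonneg_mat A" and "definite A"
  shows "0 \<le> kleene_star A $ i $ j"
proof -
  have "0 \<le> max_power A 0 $ i $ j" by (simp add: mat_def)
  then show ?thesis using max_power_le_kleene_star[OF assms] order_trans by blast
qed

lemma kleene_star_diag_ge_1:
  assumes "nonneg_mat A" and "definite A"
  shows "1 \<le> kleene_star A $ i $ i"
  using max_power_le_kleene_star[OF assms, of 0 i i] by (simp add: mat_def)

text \<open>Multiplying a power by \<open>A\<close> gives the next power, which the star still
  dominates; then the supremum over all powers is taken.\<close>

lemma kleene_star_subeigen:
  assumes "nonneg_mat A" and "definite A"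
  shows "A $ i $ j * kleene_star A $ j $ k \<le> kleene_star A $ i $ k"
proof (cases "A $ i $ j = 0")
  case True
  then show ?thesis using kleene_star_nonneg[OF assms] by simp
next
  case False
  then have pos: "0 < A $ i $ j"
    using assms(1) unfolding nonneg_mat_def by (metis order_le_less)
  \<comment> \<open>Dividing by the positive entry leaves a bound free of \<open>m\<close>, which
    passes to the supremum.\<close>
  have "max_power A m $ j $ k \<le> kleene_star A $ i $ k / A $ i $ j" for m
  proof -
    have "A $ i $ j * max_power A m $ j $ k \<le> max_power A (Suc m) $ i $ k"
      by (simp add: max_mult_ge)
    also have "\<dots> \<le> kleene_star A $ i $ k"
      by (rule max_power_le_kleene_star[OF assms])
    finally show ?thesis using pos by (simp add: field_simps)
  qed
  then have "kleene_star A $ j $ k \<le> kleene_star A $ i $ k / A $ i $ j"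
    unfolding kleene_star_def[of A] by (auto simp: kleene_star_def intro: cSUP_least)
  then show ?thesis using pos by (simp add: field_simps)
qed

text \<open>The edge from \<open>i\<close> to \<open>j\<close> closes a path from \<open>j\<close>
  to \<open>i\<close> of weight at least the star entry. The resulting cycle contains a noncritical
  edge, so its weight is below 1, while the diagonal of the star is at least 1.\<close>

lemma kleene_star_strict_subeigen:
  assumes "nonneg_mat A" and "definite A" and "(i, j) \<notin> critical_edges A"
  shows "A $ i $ j * kleene_star A $ j $ i < kleene_star A $ i $ i"
proof -
  obtain q where q: "q \<noteq> []" "hd q = j" "last q = i" "kleene_star A $ j $ i \<le> path_weight A q"
    using kleene_star_le_path_weight[OF assms(1,2), of j i] by metis
  \<comment> \<open>Exposing the last node \<open>i\<close> of \<open>q\<close> shows the closing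
    edge of the cycle; for \<open>i = j\<close> the list \<open>p\<close> may be empty and the cycle
    a loop.\<close>
  define p where "p = butlast q"
  have pq: "q = p @ [i]" using q append_butlast_last_id[of q] by (simp add: p_def)
  have cyc: "cycle_path q = p @ i # [j]" using q(2) by (simp add: cycle_path_def pq)
  have weight: "path_weight A (cycle_path q) = path_weight A q * A $ i $ j"
    unfolding cyc path_weight_append[of A p i "[j]"] by (simp add: pq)
  have "(i, j) \<in> set (path_edges (cycle_path q))"
    unfolding cyc path_edges_def
  proof (induction p)
    case (Cons a p)
    then show ?case by (cases p) auto
  qed simp
  then have "\<not> critical_cycle A q"
    using assms(3) unfolding critical_edges_def by blast
  then have "path_weight A (cycle_path q) < 1"
    using definite_cycle_weight_le_1[OF assms(1,2) q(1)] q(1)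
    by (simp add: definite_critical_cycle_iff[OF assms(2)])
  moreover have "A $ i $ j * kleene_star A $ j $ i \<le> A $ i $ j * path_weight A q"
    using assms(1) q(4) by (intro mult_left_mono) (auto simp: nonneg_mat_def)
  ultimately show ?thesis
    using weight kleene_star_diag_ge_1[OF assms(1,2), of i] by (simp add: mult.commute)
qed

section \<open>Means of all columns of the star as strict subeigenvectors\<close>

lemma prod_strict_mono_one:
  fixes f g :: "'a \<Rightarrow> real"
  assumes "finite S" and "a \<in> S" and "f a < g a"
    and "\<And>k. k \<in> S \<Longrightarrow> 0 \<le> f k \<and> f k \<le> g k \<and> 0 < g k"
  shows "prod f S < prod g S"
proof -
  have "prod f (S - {a}) \<le> prod g (S - {a})" "0 < prod g (S - {a})"
    using assms(4) by (auto intro!: prod_mono prod_pos)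
  moreover have "0 \<le> f a" using assms(2,4) by blast
  ultimately have "f a * prod f (S - {a}) < g a * prod g (S - {a})"
    using assms(3) by (meson mult_left_mono mult_strict_right_mono order_le_less_trans)
  then show ?thesis using assms(1,2) by (simp add: prod.remove)
qed

lemma pos_linear_comb_subeigen:
  fixes A :: "real ^ 'n ^ 'n"
  assumes A: "nonneg_mat A" "definite A"
    and x: "pos_linear_comb (\<lambda>k. column k (kleene_star A)) x"
  shows "A $ i $ j * x $ j \<le> x $ i"
    and "(i, j) \<notin> critical_edges A \<Longrightarrow> A $ i $ j * x $ j < x $ i"
proof -
  obtain \<mu> where \<mu>: "\<And>k. \<mu> k > 0" and
    x: "x = (\<Sum>k\<in>UNIV. \<mu> k *\<^sub>R column k (kleene_star A))"
    using x unfolding pos_linear_comb_def by blast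
  have xi: "x $ l = (\<Sum>k\<in>UNIV. \<mu> k * kleene_star A $ l $ k)" for l
    by (simp add: x column_def)
  have Ax: "A $ i $ j * x $ j = (\<Sum>k\<in>UNIV. \<mu> k * (A $ i $ j * kleene_star A $ j $ k))"
    by (simp add: xi sum_distrib_left mult_ac)
  have le: "\<mu> k * (A $ i $ j * kleene_star A $ j $ k) \<le> \<mu> k * kleene_star A $ i $ k" for k
    using kleene_star_subeigen[OF A] \<mu> by (simp add: mult_left_mono order_less_imp_le)
  then show "A $ i $ j * x $ j \<le> x $ i"
    unfolding Ax xi[of i] by (intro sum_mono)
  assume "(i, j) \<notin> critical_edges A"
  \<comment> \<open>Column \<open>i\<close> has a positive coefficient and supplies the one strict
    summand.\<close>
  then have "\<mu> i * (A $ i $ j * kleene_star A $ j $ i) < \<mu> i * kleene_star A $ i $ i"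
    using kleene_star_strict_subeigen[OF A] \<mu> by simp
  with le show "A $ i $ j * x $ j < x $ i"
    unfolding Ax xi[of i] by (intro sum_strict_mono_ex1) auto
qed

lemma pos_log_convex_comb_subeigen:
  fixes A :: "real ^ 'n ^ 'n"
  assumes A: "nonneg_mat A" "definite A" and pos: "\<And>i. x $ i > 0"
    and x: "pos_log_convex_comb (\<lambda>k. column k (kleene_star A)) x"
  shows "A $ i $ j * x $ j \<le> x $ i"
    and "(i, j) \<notin> critical_edges A \<Longrightarrow> A $ i $ j * x $ j < x $ i"
proof -
  obtain \<mu> where \<mu>: "\<And>k. \<mu> k > 0" and sum: "(\<Sum>k\<in>UNIV. \<mu> k) = 1" and
    x: "x = (\<chi> i. \<Prod>k\<in>UNIV. (column k (kleene_star A) $ i) powr \<mu> k)"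
    using x unfolding pos_log_convex_comb_def by blast
  have xi: "x $ l = (\<Prod>k\<in>UNIV. (kleene_star A $ l $ k) powr \<mu> k)" for l
    by (simp add: x column_def)
  \<comment> \<open>A single zero entry in row \<open>l\<close> would annihilate the product and
    contradict the positivity of \<open>x\<close>.\<close>
  have Kpos: "0 < kleene_star A $ l $ k" for l k
  proof -
    have "kleene_star A $ l $ k \<noteq> 0"
    proof
      assume "kleene_star A $ l $ k = 0"
      then have "x $ l = 0" unfolding xi by (intro prod_zero) (auto intro: bexI[of _ k])
      then show False using pos[of l] by simp
    qed
    then show ?thesis using kleene_star_nonneg[OF A, of l k] by simp
  qed
  have A0: "0 \<le> A $ i $ j" using A(1) by (simp add: nonneg_mat_def)
  \<comment> \<open>The exponents sum to 1, so the factor can be distributed over the columns. A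
    zero entry agrees too, since \<open>0 powr \<mu> k\<close> is 0.\<close>
  have "A $ i $ j = (\<Prod>k\<in>UNIV. A $ i $ j powr \<mu> k)"
  proof (cases "A $ i $ j = 0")
    case False
    then show ?thesis using A0 sum by (simp add: powr_sum[symmetric])
  qed simp
  then have Ax: "A $ i $ j * x $ j = (\<Prod>k\<in>UNIV. (A $ i $ j * kleene_star A $ j $ k) powr \<mu> k)"
    using A0 Kpos by (simp add: xi prod.distrib powr_mult order_less_imp_le)
  have le: "(A $ i $ j * kleene_star A $ j $ k) powr \<mu> k \<le> (kleene_star A $ i $ k) powr \<mu> k" for k
    using kleene_star_subeigen[OF A] \<mu>[of k] A0 Kpos
    by (intro powr_mono2) (auto simp: order_less_imp_le)
  then show "A $ i $ j * x $ j \<le> x $ i"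
    unfolding Ax xi[of i] by (intro prod_mono) auto
  assume "(i, j) \<notin> critical_edges A"
  then have "(A $ i $ j * kleene_star A $ j $ i) powr \<mu> i < (kleene_star A $ i $ i) powr \<mu> i"
    using kleene_star_strict_subeigen[OF A] \<mu>[of i] A0 Kpos
    by (intro powr_less_mono2) (auto simp: order_less_imp_le)
  with le show "A $ i $ j * x $ j < x $ i"
    unfolding Ax xi[of i] using Kpos[of i]
    by (intro prod_strict_mono_one[of _ i]) (auto simp: less_le)
qed

section \<open>Diagonal similarity and its effect on cycles\<close>

lemma matrix_inv_eqI:
  assumes "A ** B = mat 1" and "B ** A = mat 1"
  shows "matrix_inv A = B"
proof -
  \<comment> \<open>\<open>matrix_inv\<close> is a choice; the witness \<open>B\<close> secures its
    defining property, and uniqueness of inverses then identifies it.\<close>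
  have "A ** matrix_inv A = mat 1 \<and> matrix_inv A ** A = mat 1"
    unfolding matrix_inv_def by (rule someI[of _ B]) (use assms in simp)
  then show ?thesis
    using assms by (metis matrix_mul_assoc matrix_mul_lid matrix_mul_rid)
qed

lemma diag_mult_left: "(diag x ** A) $ i $ j = x $ i * A $ i $ j"
  by (simp add: diag_def matrix_matrix_mult_def if_distrib if_distribR cong: if_cong)

lemma diag_mult_right: "(A ** diag x) $ i $ j = A $ i $ j * x $ j"
  by (simp add: diag_def matrix_matrix_mult_def if_distrib if_distribR cong: if_cong)

lemma matrix_inv_diag:
  assumes "\<And>i. x $ i \<noteq> 0"
  shows "matrix_inv (diag x) = diag (\<chi> i. 1 / x $ i)"
proof (rule matrix_inv_eqI)
  show "diag x ** diag (\<chi> i. 1 / x $ i) = mat 1" "diag (\<chi> i. 1 / x $ i) ** diag x = mat 1"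
    using assms by (simp_all add: vec_eq_iff diag_mult_left) (simp_all add: diag_def mat_def)
qed

lemma diag_scaling_nth:
  assumes "\<And>i. x $ i \<noteq> 0"
  shows "(matrix_inv (diag x) ** A ** diag x) $ i $ j = A $ i $ j * x $ j / x $ i"
  by (simp add: matrix_inv_diag[OF assms] diag_mult_left diag_mult_right)

lemma cycle_weight_scaling:
  fixes A B :: "real ^ 'n ^ 'n"
  assumes "\<And>i. x $ i \<noteq> 0" and "\<And>i j. B $ i $ j = A $ i $ j * x $ j / x $ i"
    and "c \<noteq> []"
  shows "path_weight B (cycle_path c) = path_weight A (cycle_path c)"
proof -
  \<comment> \<open>The scaling ratios telescope along an open path; on a cycle the two remaining
    factors cancel.\<close>
  have path: "path_weight B (i # p) = path_weight A (i # p) * x $ last (i # p) / x $ i" for i p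
  proof (induction p arbitrary: i)
    case (Cons j p)
    then show ?case using assms(1)[of j] by (auto simp: assms(2))
  qed (use assms(1) in simp)
  obtain i p where "c = i # p" using assms(3) by (cases c) auto
  then show ?thesis using path[of i "p @ [i]"] assms(1)[of i] by (simp add: cycle_path_def)
qed

section \<open>Critical edges and strict visualization\<close>

lemma prod_list_le_1:
  fixes xs :: "real list"
  assumes "\<And>a. a \<in> set xs \<Longrightarrow> 0 \<le> a \<and> a \<le> 1"
  shows "prod_list xs \<le> 1"
  using assms by (induction xs) (auto intro!: mult_le_one prod_list_nonneg)

lemma prod_list_eq_1_imp:
  fixes xs :: "real list"
  assumes "\<And>a. a \<in> set xs \<Longrightarrow> 0 \<le> a \<and> a \<le> 1" and "prod_list xs = 1" and "a \<in> set xs"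
  shows "a = 1"
proof -
  obtain ys zs where xs: "xs = ys @ a # zs" using split_list[OF assms(3)] by blast
  have b: "0 \<le> a" "a \<le> 1" using assms(1,3) by auto
  have "prod_list (ys @ zs) \<le> 1" by (rule prod_list_le_1) (use assms(1) xs in auto)
  \<comment> \<open>The left side is the whole product, that is 1, so \<open>a\<close> is also at
    least 1.\<close>
  then have "a * prod_list (ys @ zs) \<le> a * 1" using b by (intro mult_left_mono)
  moreover have "a * prod_list (ys @ zs) = 1" using assms(2) xs by (simp add: mult_ac)
  ultimately show ?thesis using b by simp
qed

lemma definite_critical_edge_eq_1:
  assumes "nonneg_mat B" and "definite B" and "\<And>i j. B $ i $ j \<le> 1"
    and "(i, j) \<in> critical_edges B"
  shows "B $ i $ j = 1"
proof -
  obtain c where c: "critical_cycle B c" "(i, j) \<in> set (path_edges (cycle_path c))"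
    using assms(4) unfolding critical_edges_def by blast
  show ?thesis
  proof (rule prod_list_eq_1_imp)
    show "prod_list (map (\<lambda>(i, j). B $ i $ j) (path_edges (cycle_path c))) = 1"
      using c(1) definite_critical_cycle_iff[OF assms(2)] by (simp add: path_weight_def)
    show "B $ i $ j \<in> set (map (\<lambda>(i, j). B $ i $ j) (path_edges (cycle_path c)))"
      using c(2) by force
  qed (use assms(1,3) in \<open>auto simp: nonneg_mat_def\<close>)
qed

text \<open>Scaling preserves cycle means, hence definiteness and critical edges. The inequalities
  for \<open>x\<close> become entry bounds by 1, strict off the critical edges; on critical edges
  the entries are then forced to equal 1.\<close>

lemma strictly_visualized_scaling:
  fixes A :: "real ^ 'n ^ 'n"
  assumes A: "nonneg_mat A" "definite A" and pos: "\<And>i. x $ i > 0"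
    and le: "\<And>i j. A $ i $ j * x $ j \<le> x $ i"
    and less: "\<And>i j. (i, j) \<notin> critical_edges A \<Longrightarrow> A $ i $ j * x $ j < x $ i"
  shows "strictly_visualized (matrix_inv (diag x) ** A ** diag x)"
proof -
  define B where "B = matrix_inv (diag x) ** A ** diag x"
  have nz: "x $ i \<noteq> 0" for i using pos[of i] by simp
  have B: "B $ i $ j = A $ i $ j * x $ j / x $ i" for i j
    unfolding B_def by (rule diag_scaling_nth[OF nz])
  have mean: "cycle_mean B c = cycle_mean A c" if "c \<noteq> []" for c
    unfolding cycle_mean_def using cycle_weight_scaling[OF nz B that] by simp
  then have max: "max_cycle_mean B = max_cycle_mean A"
    unfolding max_cycle_mean_def by simp
  then have "critical_cycle B c \<longleftrightarrow> critical_cycle A c" for c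
    using mean unfolding critical_cycle_def by auto
  then have crit: "critical_edges B = critical_edges A"
    by (simp add: critical_edges_def)
  have "definite B" using A(2) max by (simp add: definite_def)
  moreover have "nonneg_mat B"
    using A(1) pos unfolding nonneg_mat_def B by (simp add: order_less_imp_le)
  moreover have "B $ i $ j \<le> 1" for i j using le pos by (simp add: B)
  moreover have "B $ i $ j < 1" if "(i, j) \<notin> critical_edges B" for i j
    using less that pos by (simp add: B crit)
  ultimately show ?thesis
    using definite_critical_edge_eq_1[of B] unfolding strictly_visualized_def B_def[symmetric]
    by (auto simp: definite_def)
qed

theorem theorem3p3:
  fixes A :: "real ^ 'n ^ 'n" and x :: "real ^ 'n"
  assumes "nonneg_mat A"
    and "definite A"
    and "\<forall>i. x $ i > 0"
    and "pos_linear_comb (\<lambda>k. column k (kleene_star A)) x \<or>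
         irreducible_mat A \<and> pos_log_convex_comb (\<lambda>k. column k (kleene_star A)) x"
  shows "strictly_visualized (matrix_inv (diag x) ** A ** diag x)"
proof -
  have pos: "x $ i > 0" for i using assms(3) by simp
  show ?thesis
    using assms(4)
  proof
    assume x: "pos_linear_comb (\<lambda>k. column k (kleene_star A)) x"
    show ?thesis
      by (rule strictly_visualized_scaling[OF assms(1,2) pos])
        (fact pos_linear_comb_subeigen[OF assms(1,2) x])+
  next
    assume x: "irreducible_mat A \<and> pos_log_convex_comb (\<lambda>k. column k (kleene_star A)) x"
    show ?thesis
      by (rule strictly_visualized_scaling[OF assms(1,2) pos])
        (fact pos_log_convex_comb_subeigen[OF assms(1,2) pos conjunct2[OF x]])+
  qed
qed

end
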